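(* Let $n\ge 3$, let $A$ be the adjacency matrix of the cycle $C_n$, and let $k\in\mathbb N^+$. PST under $A^k$ between distinct vertices $a,b$ of $C_n$ occurs if and only if either $n=4$ and $a,b$ are antipodal (with $k\in\mathbb N^+$ arbitrary), or $n=8$, $a,b$ are antipodal, and $k$ is even. The minimum positive transfer times are $\pi/2^k$ for $C_4$, and $\pi/2^q$ for $C_8$ when $k=2q$.
   Context: $\mathbb N^+=\{1,2,3,\ldots\}$. $C_n$ is the cycle on $n$ vertices; for even $n$, two vertices are antipodal if they are at distance $n/2$. A real symmetric matrix $K$ indexed by a finite vertex set has perfect state transfer (PST) from vertex $a$ to vertex $b$ at time $\tau>0$ (a transfer time) if $\exp(-\mathrm i\tau K)e_a=\gamma e_b$ for some $\gamma\in\mathbb C$ with $|\gamma|=1$, where $e_v$ is the standard basis vector indexed by $v$; PST under $K$ between $a$ and $b$ occurs if this holds for some $\tau>0$. *)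

theory Defs
  imports Complex_Main "Jordan_Normal_Form.Matrix"
begin

(* A graph on the vertex set {..<n} is given by its symmetric, irreflexive edge relation. *)
definition cycle_edges :: "nat \<Rightarrow> (nat \<times> nat) set" where
  "cycle_edges n = {(i, j). i < n \<and> j < n \<and> (j = (i + 1) mod n \<or> i = (j + 1) mod n)}"

definition adjacency_matrix :: "nat \<Rightarrow> (nat \<times> nat) set \<Rightarrow> real mat" where
  "adjacency_matrix n E = mat n n (\<lambda>(i, j). if (i, j) \<in> E then 1 else 0)"

(* E ^^ d relates the end points of walks of length d. The value is meaningful only if
   b is reachable from a, which always holds in a cycle. *)
definition graph_dist :: "(nat \<times> nat) set \<Rightarrow> nat \<Rightarrow> nat \<Rightarrow> nat" where
  "graph_dist E a b = (LEAST d. (a, b) \<in> E ^^ d)"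

definition antipodal :: "nat \<Rightarrow> nat \<Rightarrow> nat \<Rightarrow> bool" where
  "antipodal n a b \<longleftrightarrow>
     even n \<and> a < n \<and> b < n \<and> graph_dist (cycle_edges n) a b = n div 2"

(* The power series of the exponential, summed entrywise; it converges for every square matrix. *)
definition mat_exp :: "complex mat \<Rightarrow> complex mat" where
  "mat_exp M = mat (dim_row M) (dim_row M)
     (\<lambda>(i, j). \<Sum>m. (M ^\<^sub>m m) $$ (i, j) / fact m)"

(* Intended for a real symmetric matrix K, whose rows and columns are indexed by the
   vertices 0, ..., dim_row K - 1. *)
definition is_transfer_time :: "real mat \<Rightarrow> nat \<Rightarrow> nat \<Rightarrow> real \<Rightarrow> bool" where
  "is_transfer_time K a b \<tau> \<longleftrightarrow>
     \<tau> > 0 \<and>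
     (\<exists>\<gamma>::complex. cmod \<gamma> = 1 \<and>
        mat_exp ((- \<i> * complex_of_real \<tau>) \<cdot>\<^sub>m map_mat complex_of_real K) *\<^sub>v unit_vec (dim_row K) a
          = \<gamma> \<cdot>\<^sub>v unit_vec (dim_row K) b)"

definition PST :: "real mat \<Rightarrow> nat \<Rightarrow> nat \<Rightarrow> bool" where
  "PST K a b \<longleftrightarrow> (\<exists>\<tau>. is_transfer_time K a b \<tau>)"

definition is_min_transfer_time :: "real mat \<Rightarrow> nat \<Rightarrow> nat \<Rightarrow> real \<Rightarrow> bool" where
  "is_min_transfer_time K a b \<tau> \<longleftrightarrow>
     is_transfer_time K a b \<tau> \<and> (\<forall>\<sigma>. is_transfer_time K a b \<sigma> \<longrightarrow> \<tau> \<le> \<sigma>)"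

end

theory Submission imports Defs "Jordan_Normal_Form.Char_Poly" begin

text \<open>
  The characters of \<open>\<int>/n\<close> diagonalise \<open>A\<close> with eigenvalues \<open>\<theta>\<^sub>j = 2 cos (2\<pi>j/n)\<close>, so a transfer from
  \<open>a\<close> to \<open>b\<close> at time \<open>\<tau>\<close> means \<open>exp (-i\<tau>\<theta>\<^sub>j\<^sup>k) = \<gamma> \<omega>\<^bsup>j(a-b)\<^esup>\<close> for all \<open>j\<close>, where \<open>\<omega> = exp (2\<pi>i/n)\<close>.
  Since \<open>\<theta>\<^sub>1 = \<theta>\<^bsub>n-1\<^esub>\<close>, the vertices are antipodal and the right-hand side is \<open>\<gamma>(-1)\<^sup>j\<close>; hence
  \<open>\<tau>(\<theta>\<^sub>j\<^sup>k - \<theta>\<^sub>l\<^sup>k)\<close> is an integer multiple of \<open>\<pi>\<close> with the parity of \<open>j + l\<close>. The symmetry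
  \<open>\<theta>\<^bsub>n/2-j\<^esub> = -\<theta>\<^sub>j\<close> turns this into rationality of the powers \<open>\<theta>\<^sub>j\<^sup>k\<close> (relative to
  \<open>\<theta>\<^sub>0\<^sup>k = 2\<^sup>k\<close>), and as eigenvalues of an integer matrix they are then integers. The smallest
  nonzero \<open>|\<theta>\<^sub>j|\<close> is \<open>2 sin (2\<pi>/n)\<close> if \<open>4\<close> divides \<open>n\<close> and \<open>2 sin (\<pi>/n)\<close> otherwise, and it must be
  at least \<open>1\<close>. This leaves \<open>n = 4, 6, 8, 12\<close>; parity excludes \<open>6\<close> and \<open>12\<close>, and irrationality of
  \<open>\<surd>2\<close> forces \<open>k\<close> to be even for \<open>n = 8\<close>.
\<close>

section \<open>Matrices diagonalised by the characters\<close>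

text \<open>The power omega^d, with an integer exponent so that differences of vertices and
  conjugate characters are covered as well.\<close>

definition rou :: "nat \<Rightarrow> int \<Rightarrow> complex" where
  "rou n d = cis (2 * pi * of_int d / real n)"

lemma rou_0 [simp]: "rou n 0 = 1"
  by (simp add: rou_def)

lemma rou_add: "rou n (c + d) = rou n c * rou n d"
  by (simp add: rou_def cis_mult distrib_left add_divide_distrib)

lemma rou_power: "rou n d ^ k = rou n (int k * d)"
  by (simp add: rou_def DeMoivre mult_ac)

lemma rou_eq_1_iff:
  assumes "n > 0"
  shows "rou n d = 1 \<longleftrightarrow> int n dvd d"
proof
  assume "rou n d = 1"
  then have "cos (2 * pi * of_int d / real n) = 1"
    by (simp add: rou_def complex_eq_iff)
  then obtain l :: int where "2 * pi * of_int d / real n = of_int l * 2 * pi"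
    using cos_one_2pi_int by blast
  then have "real_of_int d = of_int (l * int n)"
    using assms by (simp add: field_simps)
  then have "d = l * int n"
    by linarith
  then show "int n dvd d" by simp
next
  assume "int n dvd d"
  then obtain l where "d = int n * l" ..
  then show "rou n d = 1"
    using assms cis_multiple_2pi[of "of_int l"] by (simp add: rou_def mult_ac)
qed

lemma rou_cong:
  assumes "n > 0" "int n dvd c - d"
  shows "rou n c = rou n d"
  using assms rou_add[of n "c - d" d] rou_eq_1_iff[of n "c - d"] by simp

text \<open>Orthogonality of the characters: a geometric sum whose ratio is an \<open>n\<close>-th
  root of unity.\<close>

lemma sum_rou:
  assumes "n > 0"
  shows "(\<Sum>x<n. rou n (d * int x)) = (if int n dvd d then of_nat n else 0)"
proof -
  have eq: "rou n (d * int x) = rou n d ^ x" for x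
    by (simp add: rou_power mult.commute)
  show ?thesis
  proof (cases "int n dvd d")
    case True
    then have "rou n d = 1" using assms by (simp add: rou_eq_1_iff)
    then show ?thesis using True by (simp add: eq)
  next
    case False
    have "rou n d ^ n = 1"
      using assms by (simp add: rou_power rou_eq_1_iff)
    then show ?thesis
      using False assms by (simp add: eq sum_gp_strict rou_eq_1_iff)
  qed
qed

lemma int_dvd_diff_iff:
  assumes "x < n" "y < n"
  shows "int n dvd int x - int y \<longleftrightarrow> x = y"
  using assms by (metis mod_eq_dvd_iff mod_less of_nat_eq_iff zmod_int)

definition character :: "nat \<Rightarrow> nat \<Rightarrow> complex vec" where
  "character n j = vec n (\<lambda>x. rou n (int j * int x))"

lemma character_carrier [simp]: "character n j \<in> carrier_vec n"
  by (simp add: character_def)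

lemma character_nonzero:
  assumes "n > 0"
  shows "character n j \<noteq> 0\<^sub>v n"
proof
  assume "character n j = 0\<^sub>v n"
  then have "character n j $ 0 = 0\<^sub>v n $ 0" by simp
  then show False using assms by (simp add: character_def)
qed

text \<open>By orthogonality the basis vector at \<open>y\<close> is the average of the characters,
  each weighted by its conjugate value at \<open>y\<close>; \<open>B ^\<^sub>m m\<close> multiplies
  the summand of index \<open>j\<close> by \<open>\<mu> j ^ m\<close>.\<close>

lemma power_entry:
  assumes B: "B \<in> carrier_mat n n"
    and ev: "\<And>j. j < n \<Longrightarrow> B *\<^sub>v character n j = \<mu> j \<cdot>\<^sub>v character n j"
    and x: "x < n" and y: "y < n"
  shows "(B ^\<^sub>m m) $$ (x, y) = (\<Sum>j<n. \<mu> j ^ m * rou n (int j * (int x - int y))) / of_nat n"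
proof -
  have n: "n > 0" using x by simp
  have C: "B ^\<^sub>m m \<in> carrier_mat n n" using B by (rule pow_carrier_mat)
  have "eigenvector B (character n j) (\<mu> j)" if "j < n" for j
    unfolding eigenvector_def using ev[OF that] B character_nonzero[OF n] by auto
  then have pow: "(B ^\<^sub>m m) *\<^sub>v character n j = \<mu> j ^ m \<cdot>\<^sub>v character n j" if "j < n" for j
    using eigenvector_pow[OF B] that by blast
  have row: "(\<Sum>z<n. (B ^\<^sub>m m) $$ (x, z) * rou n (int j * int z)) = \<mu> j ^ m * rou n (int j * int x)"
    if "j < n" for j
    using arg_cong[OF pow[OF that], of "\<lambda>v. v $ x"] B C x
    by (simp add: character_def scalar_prod_def lessThan_atLeast0)
  \<comment> \<open>The Kronecker delta at \<open>z = y\<close> is written as a character sum, so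
    that swapping the sums makes \<open>row\<close> applicable.\<close>
  have "of_nat n * (B ^\<^sub>m m) $$ (x, y) =
      (\<Sum>z<n. (B ^\<^sub>m m) $$ (x, z) * (\<Sum>j<n. rou n ((int z - int y) * int j)))"
    using y n by (simp add: sum_rou int_dvd_diff_iff if_distrib cong: if_cong)
  also have "\<dots> = (\<Sum>z<n. \<Sum>j<n. (B ^\<^sub>m m) $$ (x, z) * rou n (int j * int z) * rou n (- int j * int y))"
    by (simp add: sum_distrib_left mult.assoc flip: rou_add)
       (simp add: algebra_simps)
  also have "\<dots> = (\<Sum>j<n. (\<Sum>z<n. (B ^\<^sub>m m) $$ (x, z) * rou n (int j * int z)) * rou n (- int j * int y))"
    by (subst sum.swap) (simp add: sum_distrib_right)
  also have "\<dots> = (\<Sum>j<n. \<mu> j ^ m * rou n (int j * int x) * rou n (- int j * int y))"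
    by (intro sum.cong) (auto simp: row)
  also have "\<dots> = (\<Sum>j<n. \<mu> j ^ m * rou n (int j * (int x - int y)))"
    by (simp add: mult.assoc flip: rou_add) (simp add: algebra_simps)
  finally show ?thesis using n by (simp add: field_simps)
qed

text \<open>Each entry is a finite combination of the scalar exponential series at the
  \<open>\<mu> j\<close>, so it can be summed termwise.\<close>

lemma mat_exp_entry:
  assumes B: "B \<in> carrier_mat n n"
    and ev: "\<And>j. j < n \<Longrightarrow> B *\<^sub>v character n j = \<mu> j \<cdot>\<^sub>v character n j"
    and x: "x < n" and y: "y < n"
  shows "mat_exp B $$ (x, y) = (\<Sum>j<n. exp (\<mu> j) * rou n (int j * (int x - int y))) / of_nat n"
proof -
  have exp: "(\<lambda>m. \<mu> j ^ m / fact m) sums exp (\<mu> j)" for j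
    using exp_converges[of "\<mu> j"] by (simp add: scaleR_conv_of_real field_simps)
  have "(\<lambda>m. (\<Sum>j<n. (\<mu> j ^ m / fact m) * rou n (int j * (int x - int y))) / of_nat n) sums
      ((\<Sum>j<n. exp (\<mu> j) * rou n (int j * (int x - int y))) / of_nat n)"
    by (intro sums_divide sums_sum sums_mult2 exp)
  also have "(\<lambda>m. (\<Sum>j<n. (\<mu> j ^ m / fact m) * rou n (int j * (int x - int y))) / of_nat n) =
      (\<lambda>m. (B ^\<^sub>m m) $$ (x, y) / fact m)"
    by (simp add: power_entry[OF B ev x y] sum_divide_distrib field_simps)
  finally show ?thesis
    using B x y by (simp add: mat_exp_def sums_iff)
qed

text \<open>Both sides are expanded in the characters; comparing coefficients turns the vector
  equation into one scalar equation per index.\<close>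

lemma mat_exp_unit_vec_iff:
  assumes B: "B \<in> carrier_mat n n"
    and ev: "\<And>j. j < n \<Longrightarrow> B *\<^sub>v character n j = \<mu> j \<cdot>\<^sub>v character n j"
    and a: "a < n" and b: "b < n"
  shows "mat_exp B *\<^sub>v unit_vec n a = \<gamma> \<cdot>\<^sub>v unit_vec n b \<longleftrightarrow>
         (\<forall>j<n. exp (\<mu> j) = \<gamma> * rou n (int j * (int a - int b)))" (is "?L \<longleftrightarrow> ?R")
proof -
  have n: "n > 0" using a by simp
  have E: "mat_exp B \<in> carrier_mat n n" using B by (simp add: mat_exp_def)
  have entry: "(mat_exp B *\<^sub>v unit_vec n a) $ x = mat_exp B $$ (x, a)" if "x < n" for x
    using E a that by simp
  have "?L \<longleftrightarrow> (\<forall>x<n. mat_exp B $$ (x, a) = (if x = b then \<gamma> else 0))"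
    using E b entry by (auto simp: vec_eq_iff)
  also have "\<dots> \<longleftrightarrow> (\<forall>x<n. (\<Sum>j<n. exp (\<mu> j) * rou n (int j * (int x - int a)))
      = (if x = b then of_nat n * \<gamma> else 0))" (is "_ \<longleftrightarrow> ?M")
    using n by (auto simp: mat_exp_entry[OF B ev _ a] field_simps)
  also have "\<dots> \<longleftrightarrow> ?R"
  proof
    assume M: ?M
    show ?R
    proof (intro allI impI)
      fix l assume l: "l < n"
      \<comment> \<open>Fourier inversion: pairing \<open>?M\<close> with the conjugate of character
        \<open>l\<close> kills every term except \<open>j = l\<close>.\<close>
      have "of_nat n * \<gamma> * rou n (- int l * int b) =
          (\<Sum>x<n. (if x = b then of_nat n * \<gamma> else 0) * rou n (- int l * int x))"
        using b by (simp add: if_distrib[where f = "\<lambda>c. c * _"] cong: if_cong)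
      also have "\<dots> = (\<Sum>x<n. (\<Sum>j<n. exp (\<mu> j) * rou n (int j * (int x - int a))) * rou n (- int l * int x))"
        using M by (intro sum.cong) auto
      also have "\<dots> = (\<Sum>x<n. \<Sum>j<n. exp (\<mu> j) * rou n (- int j * int a) * rou n ((int j - int l) * int x))"
        by (simp add: sum_distrib_right mult.assoc flip: rou_add)
           (simp add: algebra_simps)
      also have "\<dots> = (\<Sum>j<n. exp (\<mu> j) * rou n (- int j * int a) * (\<Sum>x<n. rou n ((int j - int l) * int x)))"
        by (subst sum.swap) (simp add: sum_distrib_left)
      also have "\<dots> = of_nat n * exp (\<mu> l) * rou n (- int l * int a)"
        using l n by (simp add: sum_rou int_dvd_diff_iff if_distrib cong: if_cong)
      finally have "\<gamma> * rou n (- int l * int b) * rou n (int l * int a) =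
          exp (\<mu> l) * rou n (- int l * int a) * rou n (int l * int a)"
        using n by simp
      then show "exp (\<mu> l) = \<gamma> * rou n (int l * (int a - int b))"
        by (simp add: mult.assoc flip: rou_add) (simp add: algebra_simps)
    qed
  next
    assume R: ?R
    show ?M
    proof (intro allI impI)
      fix x assume x: "x < n"
      have "(\<Sum>j<n. exp (\<mu> j) * rou n (int j * (int x - int a))) =
          (\<Sum>j<n. \<gamma> * rou n ((int x - int b) * int j))"
        using R by (intro sum.cong) (auto simp: mult.assoc algebra_simps simp flip: rou_add)
      also have "\<dots> = (if x = b then of_nat n * \<gamma> else 0)"
        using x b n by (simp add: sum_rou int_dvd_diff_iff flip: sum_distrib_left)
      finally show "(\<Sum>j<n. exp (\<mu> j) * rou n (int j * (int x - int a)))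
          = (if x = b then of_nat n * \<gamma> else 0)" .
    qed
  qed
  finally show ?thesis .
qed

section \<open>Spectrum of the cycle and of the powers of its adjacency matrix\<close>

definition cycle_eigenvalue :: "nat \<Rightarrow> nat \<Rightarrow> real" where
  "cycle_eigenvalue n j = 2 * cos (2 * pi * real j / real n)"

lemma cycle_eigenvalue_rou:
  "complex_of_real (cycle_eigenvalue n j) = rou n (int j) + rou n (- int j)"
  by (simp add: cycle_eigenvalue_def rou_def complex_eq_iff)

text \<open>The predecessor is written \<open>x + (n - 1)\<close> because \<open>x - 1\<close> would
  be truncated at \<open>x = 0\<close>.\<close>

lemma cycle_neighbours:
  assumes "n > 0" "x < n"
  shows "{z. (x, z) \<in> cycle_edges n} = {(x + 1) mod n, (x + (n - 1)) mod n}"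
proof -
  have "x = (z + 1) mod n \<longleftrightarrow> z = (x + (n - 1)) mod n" if "z < n" for z
    using assms that by (cases "z + 1 = n"; cases "x = 0") (auto simp: mod_if)
  then show ?thesis
    using assms by (auto simp: cycle_edges_def)
qed

lemma adjacency_eigenvector:
  assumes n: "n \<ge> 3"
  shows "map_mat complex_of_real (adjacency_matrix n (cycle_edges n)) *\<^sub>v character n j =
    complex_of_real (cycle_eigenvalue n j) \<cdot>\<^sub>v character n j" (is "?A *\<^sub>v _ = _")
proof (rule eq_vecI)
  show "dim_vec (?A *\<^sub>v character n j) = dim_vec (complex_of_real (cycle_eigenvalue n j) \<cdot>\<^sub>v character n j)"
    by (simp add: character_def adjacency_matrix_def)
  fix x assume "x < dim_vec (complex_of_real (cycle_eigenvalue n j) \<cdot>\<^sub>v character n j)"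
  then have x: "x < n" by (simp add: character_def)
  \<comment> \<open>On one or two vertices the two neighbours would coincide and the sum below would
    have a single term.\<close>
  have ne: "(x + 1) mod n \<noteq> (x + (n - 1)) mod n"
    using n x by (auto simp: mod_if split: if_splits)
  have sub: "{z. (x, z) \<in> cycle_edges n} \<subseteq> {..<n}"
    by (auto simp: cycle_edges_def)
  have "(?A *\<^sub>v character n j) $ x =
      (\<Sum>z<n. if (x, z) \<in> cycle_edges n then rou n (int j * int z) else 0)"
    using x by (simp add: adjacency_matrix_def character_def scalar_prod_def lessThan_atLeast0
        if_distrib[where f = "\<lambda>c. c * _"] if_distrib[where f = complex_of_real] cong: if_cong)
  also have "\<dots> = (\<Sum>z\<in>{z. (x, z) \<in> cycle_edges n}. rou n (int j * int z))"
    using sub by (intro sum.mono_neutral_cong_right) auto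
  also have "\<dots> = rou n (int j * int ((x + 1) mod n)) + rou n (int j * int ((x + (n - 1)) mod n))"
    using cycle_neighbours[of n x] n x ne by simp
  also have "rou n (int j * int ((x + 1) mod n)) = rou n (int j * (int x + 1))"
  proof (rule rou_cong)
    have "int ((x + 1) mod n) mod int n = (int x + 1) mod int n"
      by (simp add: zmod_int add.commute)
    then show "int n dvd int j * int ((x + 1) mod n) - int j * (int x + 1)"
      by (metis dvd_mult mod_eq_dvd_iff right_diff_distrib)
  qed (use n in simp)
  also have "rou n (int j * int ((x + (n - 1)) mod n)) = rou n (int j * (int x - 1))"
  proof (rule rou_cong)
    have "int ((x + (n - 1)) mod n) mod int n = (int x - 1) mod int n"
      using n by (simp add: zmod_int of_nat_diff algebra_simps) (metis add_diff_eq mod_add_self1)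
    then show "int n dvd int j * int ((x + (n - 1)) mod n) - int j * (int x - 1)"
      by (metis dvd_mult mod_eq_dvd_iff right_diff_distrib)
  qed (use n in simp)
  finally show "(?A *\<^sub>v character n j) $ x = (complex_of_real (cycle_eigenvalue n j) \<cdot>\<^sub>v character n j) $ x"
    using x by (simp add: cycle_eigenvalue_rou character_def distrib_right flip: rou_add)
      (simp add: algebra_simps)
qed

lemma adjacency_carrier [simp]: "adjacency_matrix n E \<in> carrier_mat n n"
  by (simp add: adjacency_matrix_def)

lemma adjacency_dim [simp]:
  "dim_row (adjacency_matrix n E) = n" "dim_col (adjacency_matrix n E) = n"
  by (simp_all add: adjacency_matrix_def)

lemma adjacency_power_eigenvector:
  assumes n: "n \<ge> 3"
  shows "map_mat complex_of_real (adjacency_matrix n (cycle_edges n) ^\<^sub>m k) *\<^sub>v character n j =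
    complex_of_real (cycle_eigenvalue n j ^ k) \<cdot>\<^sub>v character n j"
proof -
  let ?A = "map_mat complex_of_real (adjacency_matrix n (cycle_edges n))"
  have "character n j \<noteq> 0\<^sub>v n" using n by (intro character_nonzero) simp
  then have "eigenvector ?A (character n j) (complex_of_real (cycle_eigenvalue n j))"
    unfolding eigenvector_def using adjacency_eigenvector[OF n, of j] by simp
  moreover have "?A \<in> carrier_mat n n" by simp
  ultimately show ?thesis
    using eigenvector_pow[of ?A n "character n j" _ k]
    by (simp add: of_real_hom.mat_hom_pow[OF adjacency_carrier])
qed

section \<open>Integrality of rational eigenvalues\<close>

text \<open>The power is a root of the monic characteristic polynomial of an integer matrix, hence
  an algebraic integer. Powers are treated directly because the eigenvalue itself may be irrational,
  as for \<open>n = 8\<close>.\<close>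

lemma rational_eigenvalue_power_int:
  assumes n: "n \<ge> 3" and rat: "cycle_eigenvalue n j ^ k \<in> \<rat>"
  shows "cycle_eigenvalue n j ^ k \<in> \<int>"
proof -
  let ?A = "adjacency_matrix n (cycle_edges n)"
  \<comment> \<open>An integer copy of the adjacency matrix, so that the characteristic polynomial
    of its power has integer coefficients.\<close>
  define Z :: "int mat" where
    "Z = mat n n (\<lambda>(x, y). if (x, y) \<in> cycle_edges n then 1 else 0)"
  have Z: "Z \<in> carrier_mat n n" by (simp add: Z_def)
  have "map_mat complex_of_real ?A = map_mat of_int Z"
    by (rule eq_matI) (auto simp: Z_def adjacency_matrix_def)
  then have AZ: "map_mat complex_of_real (?A ^\<^sub>m k) = map_mat of_int (Z ^\<^sub>m k)"
    by (simp add: of_real_hom.mat_hom_pow[OF adjacency_carrier] of_int_hom.mat_hom_pow[OF Z])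
  let ?B = "map_mat complex_of_real (?A ^\<^sub>m k)"
  have B: "?B \<in> carrier_mat n n" by (simp add: pow_carrier_mat)
  have Zk: "Z ^\<^sub>m k \<in> carrier_mat n n" using Z by (rule pow_carrier_mat)
  have "character n j \<noteq> 0\<^sub>v n" using n by (intro character_nonzero) simp
  then have "eigenvector ?B (character n j) (complex_of_real (cycle_eigenvalue n j ^ k))"
    unfolding eigenvector_def using adjacency_power_eigenvector[OF n, of k j] B by auto
  then have "poly (char_poly ?B) (complex_of_real (cycle_eigenvalue n j ^ k)) = 0"
    using eigenvalue_root_char_poly[OF B] by (auto simp: eigenvalue_def)
  then have "poly (map_poly of_int (char_poly (Z ^\<^sub>m k))) (complex_of_real (cycle_eigenvalue n j ^ k)) = 0"
    by (simp add: AZ of_int_hom.char_poly_hom[OF Zk])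
  moreover have "lead_coeff (char_poly (Z ^\<^sub>m k)) = 1"
    using degree_monic_char_poly[OF Zk] by simp
  ultimately have "algebraic_int (complex_of_real (cycle_eigenvalue n j ^ k))"
    unfolding algebraic_int_altdef_ipoly by blast
  then show ?thesis
    using rat rational_algebraic_int_is_int algebraic_int_of_real_iff by blast
qed

section \<open>Transfer times and phases\<close>

lemma is_transfer_time_iff:
  assumes n: "n \<ge> 3" and a: "a < n" and b: "b < n"
  shows "is_transfer_time (adjacency_matrix n (cycle_edges n) ^\<^sub>m k) a b \<tau> \<longleftrightarrow>
    \<tau> > 0 \<and> (\<exists>\<gamma>. cmod \<gamma> = 1 \<and>
      (\<forall>j<n. exp (- \<i> * of_real (\<tau> * cycle_eigenvalue n j ^ k)) =
        \<gamma> * rou n (int j * (int a - int b))))"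
proof -
  let ?K = "adjacency_matrix n (cycle_edges n) ^\<^sub>m k"
  let ?c = "- \<i> * complex_of_real \<tau>"
  let ?B = "?c \<cdot>\<^sub>m map_mat complex_of_real ?K"
  have K: "?K \<in> carrier_mat n n" by (simp add: pow_carrier_mat)
  then have B: "?B \<in> carrier_mat n n" by simp
  have ev: "?B *\<^sub>v character n j =
      (- \<i> * of_real (\<tau> * cycle_eigenvalue n j ^ k)) \<cdot>\<^sub>v character n j" for j
  proof -
    have "?B *\<^sub>v character n j = ?c \<cdot>\<^sub>v (map_mat complex_of_real ?K *\<^sub>v character n j)"
      using K by (intro eq_vecI) (auto simp: character_def scalar_prod_def sum_distrib_left mult.assoc simp flip: sum_negf)
    then show ?thesis
      by (simp only: adjacency_power_eigenvector[OF n]) (simp add: smult_smult_assoc mult.assoc)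
  qed
  have "dim_row ?K = n" using K by blast
  then show ?thesis
    unfolding is_transfer_time_def
    by (simp only: mat_exp_unit_vec_iff[OF B ev a b])
qed

text \<open>Characters \<open>1\<close> and \<open>n - 1\<close> share an eigenvalue, hence a phase,
  which forces omega^(2(a-b)) = 1.\<close>

lemma transfer_time_antipodal_offset:
  assumes n: "n \<ge> 3" and a: "a < n" and b: "b < n" and ab: "a \<noteq> b"
    and t: "is_transfer_time (adjacency_matrix n (cycle_edges n) ^\<^sub>m k) a b \<tau>"
  shows "even n \<and> b = (a + n div 2) mod n"
proof -
  obtain \<gamma> where \<gamma>: "cmod \<gamma> = 1" and
    ph: "\<And>j. j < n \<Longrightarrow> exp (- \<i> * of_real (\<tau> * cycle_eigenvalue n j ^ k)) =
        \<gamma> * rou n (int j * (int a - int b))"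
    using t is_transfer_time_iff[OF n a b] by blast
  have eig: "cycle_eigenvalue n (n - 1) = cycle_eigenvalue n 1"
  proof -
    have "2 * pi * real (n - 1) / real n = 2 * pi - 2 * pi * real 1 / real n"
      using n by (simp add: of_nat_diff field_simps)
    then show ?thesis by (simp only: cycle_eigenvalue_def cos_2pi_minus)
  qed
  have "1 < n" "n - 1 < n" using n by auto
  then have "\<gamma> * rou n (int (n - 1) * (int a - int b)) = \<gamma> * rou n (int 1 * (int a - int b))"
    by (simp only: eig flip: ph)
  moreover have "\<gamma> \<noteq> 0" using \<gamma> by auto
  ultimately have "rou n (int (n - 1) * (int a - int b)) = rou n (int 1 * (int a - int b))"
    by (metis mult_left_cancel)
  moreover have "rou n (int (n - 1) * (int a - int b)) = rou n (- (int a - int b))"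
    using n by (intro rou_cong) (auto simp: of_nat_diff algebra_simps)
  ultimately have "rou n (int a - int b) * rou n (int a - int b) =
      rou n (int a - int b) * rou n (- (int a - int b))" by simp
  then have "int n dvd 2 * (int a - int b)"
    using n by (simp add: rou_eq_1_iff flip: rou_add)
  then obtain q where q: "2 * (int a - int b) = int n * q" ..
  \<comment> \<open>Distinct vertices differ by less than \<open>n\<close>, so 2(a-b) is nonzero and
    below 2n in absolute value.\<close>
  have "\<bar>q\<bar> = 1"
  proof -
    have "q \<noteq> 0" using q ab by auto
    moreover have "\<bar>q\<bar> < 2"
    proof (rule ccontr)
      assume "\<not> \<bar>q\<bar> < 2"
      then have "int n * 2 \<le> int n * \<bar>q\<bar>" by (intro mult_left_mono) auto
      also have "\<dots> = \<bar>2 * (int a - int b)\<bar>" by (simp only: q abs_mult abs_of_nat)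
      finally have "int n * 2 \<le> \<bar>2 * (int a - int b)\<bar>" .
      then show False using a b by (auto simp: abs_if split: if_splits)
    qed
    ultimately show ?thesis by linarith
  qed
  then have "2 * (int a - int b) = int n \<or> 2 * (int a - int b) = - int n"
    using q by (auto simp: abs_if split: if_splits)
  then have "2 * a = n + 2 * b \<or> 2 * b = n + 2 * a" by presburger
  then show ?thesis
  proof
    assume h: "2 * a = n + 2 * b"
    then have "even n" by presburger
    moreover have "a + n div 2 = b + n" using h by presburger
    ultimately show ?thesis using b by simp
  next
    assume h: "2 * b = n + 2 * a"
    then have "even n" by presburger
    moreover have "a + n div 2 = b" using h by presburger
    ultimately show ?thesis using b by simp
  qed
qed

text \<open>omega^(n/2) = -1, and a-b is congruent to n/2 modulo \<open>n\<close>.\<close>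

lemma rou_antipodal_offset:
  assumes n: "n > 0" "even n" and b: "b = (a + n div 2) mod n"
  shows "rou n (int j * (int a - int b)) = (-1) ^ j"
proof -
  obtain m where m: "n = 2 * m" using n by (elim evenE)
  have "int b mod int n = (int a + int m) mod int n"
    using b m by (simp add: zmod_int)
  then have "int n dvd int b - (int a + int m)" by (simp add: mod_eq_dvd_iff)
  then have "int n dvd - (int b - (int a + int m))" by (simp only: dvd_minus_iff)
  then have "rou n (int a - int b) = rou n (- int m)"
    using n by (intro rou_cong) (auto simp: algebra_simps)
  also have "\<dots> = -1"
    using n m by (simp add: rou_def complex_eq_iff)
  finally show ?thesis
    by (metis rou_power)
qed

lemma transfer_time_antipodal_iff:
  assumes n: "n \<ge> 3" "even n" and a: "a < n" and b: "b = (a + n div 2) mod n"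
  shows "is_transfer_time (adjacency_matrix n (cycle_edges n) ^\<^sub>m k) a b \<tau> \<longleftrightarrow>
    \<tau> > 0 \<and> (\<exists>\<gamma>. cmod \<gamma> = 1 \<and>
      (\<forall>j<n. exp (- \<i> * of_real (\<tau> * cycle_eigenvalue n j ^ k)) = \<gamma> * (-1) ^ j))"
proof -
  have "b < n" using n b by simp
  then show ?thesis
    using is_transfer_time_iff[OF n(1) a] rou_antipodal_offset[OF _ n(2) b] n by simp
qed

lemma exp_minus_i_eq_sign:
  assumes "exp (- \<i> * complex_of_real t) = (-1) ^ p"
  obtains N :: int where "t = pi * of_int N" "even N \<longleftrightarrow> even p"
proof -
  have c: "cos t = (-1) ^ p"
    using arg_cong[OF assms, of Re] by (cases "even p") (auto simp: Re_exp)
  show ?thesis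
  proof (cases "even p")
    case True
    then have "cos t = 1" using c by simp
    then obtain l :: int where "t = of_int l * 2 * pi" using cos_one_2pi_int by blast
    then show ?thesis using True that[of "2 * l"] by simp
  next
    case False
    \<comment> \<open>A shift by pi reduces the odd case to the cosine value 1.\<close>
    then have "cos (t + pi) = 1" using c by simp
    then obtain l :: int where "t + pi = of_int l * 2 * pi" using cos_one_2pi_int by blast
    then show ?thesis using False that[of "2 * l - 1"] by (simp add: algebra_simps)
  qed
qed

text \<open>Dividing two phases eliminates the unknown \<open>\<gamma>\<close>. The later necessary
  conditions and lower bounds for transfer times all start here.\<close>

lemma transfer_time_parity:
  assumes n: "n \<ge> 3" "even n" and a: "a < n" and b: "b = (a + n div 2) mod n"
    and t: "is_transfer_time (adjacency_matrix n (cycle_edges n) ^\<^sub>m k) a b \<tau>"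
    and j: "j < n" and l: "l < n"
  obtains N :: int
  where "\<tau> * (cycle_eigenvalue n j ^ k - cycle_eigenvalue n l ^ k) = pi * of_int N"
    "even N \<longleftrightarrow> even (j + l)"
proof -
  obtain \<gamma> where \<gamma>: "cmod \<gamma> = 1" and
    ph: "\<And>j. j < n \<Longrightarrow> exp (- \<i> * of_real (\<tau> * cycle_eigenvalue n j ^ k)) = \<gamma> * (-1) ^ j"
    using t transfer_time_antipodal_iff[OF n a b] by blast
  have "exp (- \<i> * of_real (\<tau> * (cycle_eigenvalue n j ^ k - cycle_eigenvalue n l ^ k))) =
      exp (- \<i> * of_real (\<tau> * cycle_eigenvalue n j ^ k)) / exp (- \<i> * of_real (\<tau> * cycle_eigenvalue n l ^ k))"
    by (simp add: algebra_simps flip: exp_diff)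
  also have "\<dots> = (-1) ^ (j + l)"
    using \<gamma> by (simp only: ph[OF j] ph[OF l]) (auto simp: power_add field_simps)
  finally show ?thesis
    using exp_minus_i_eq_sign that by blast
qed

section \<open>Antipodal vertices of the cycle\<close>

lemma eq_mod_iff_int_dvd:
  assumes "y < n"
  shows "y = (x + d) mod n \<longleftrightarrow> int n dvd int y - int x - int d"
proof -
  have "y = (x + d) mod n \<longleftrightarrow> y mod n = (x + d) mod n"
    using assms by simp
  also have "\<dots> \<longleftrightarrow> int y mod int n = int (x + d) mod int n"
    by (simp only: of_nat_eq_iff flip: of_nat_mod)
  also have "\<dots> \<longleftrightarrow> int n dvd int y - int x - int d"
    by (simp only: mod_eq_dvd_iff of_nat_add diff_diff_eq)
  finally show ?thesis .
qed

text \<open>Each edge changes the position by 1 or -1 modulo \<open>n\<close>; \<open>s\<close> is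
  the net displacement before reduction.\<close>

lemma cycle_walk_offset:
  assumes "(x, y) \<in> cycle_edges n ^^ d"
  shows "\<exists>s::int. \<bar>s\<bar> \<le> int d \<and> int n dvd int y - int x - s"
  using assms
proof (induction d arbitrary: y)
  case 0
  then show ?case by auto
next
  case (Suc d)
  then obtain z where z: "(x, z) \<in> cycle_edges n ^^ d" "(z, y) \<in> cycle_edges n" by auto
  obtain s where s: "\<bar>s\<bar> \<le> int d" "int n dvd int z - int x - s" using Suc.IH[OF z(1)] by blast
  from z(2) have "y < n" "z < n" "y = (z + 1) mod n \<or> z = (y + 1) mod n"
    by (auto simp: cycle_edges_def)
  then have "int n dvd int y - int z - int 1 \<or> int n dvd int z - int y - int 1"
    by (simp only: eq_mod_iff_int_dvd)
  moreover have "int z - int y - int 1 = - (int y - int z + 1)" by simp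
  ultimately have "int n dvd int y - int z - 1 \<or> int n dvd int y - int z + 1"
    by (simp only: dvd_minus_iff of_nat_1)
  then show ?case
  proof
    assume "int n dvd int y - int z - 1"
    from dvd_add[OF this s(2)] have "int n dvd int y - int x - (s + 1)" by (simp add: algebra_simps)
    then show ?thesis using s(1) by (intro exI[of _ "s + 1"]) auto
  next
    assume "int n dvd int y - int z + 1"
    from dvd_add[OF this s(2)] have "int n dvd int y - int x - (s - 1)" by (simp add: algebra_simps)
    then show ?thesis using s(1) by (intro exI[of _ "s - 1"]) auto
  qed
qed

lemma cycle_walk_forward:
  assumes "x < n"
  shows "(x, (x + d) mod n) \<in> cycle_edges n ^^ d"
proof (induction d)
  case 0
  then show ?case using assms by simp
next
  case (Suc d)
  have "((x + d) mod n, (x + Suc d) mod n) \<in> cycle_edges n"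
    using assms by (auto simp: cycle_edges_def mod_Suc_eq)
  then show ?case using Suc by auto
qed

lemma cycle_walk_sym: "(x, y) \<in> cycle_edges n ^^ d \<Longrightarrow> (y, x) \<in> cycle_edges n ^^ d"
proof (induction d arbitrary: y)
  case 0
  then show ?case by simp
next
  case (Suc d)
  then obtain z where "(x, z) \<in> cycle_edges n ^^ d" "(z, y) \<in> cycle_edges n" by auto
  then have "(z, x) \<in> cycle_edges n ^^ d" "(y, z) \<in> cycle_edges n"
    using Suc.IH by (auto simp: cycle_edges_def)
  then show ?case by (rule relpow_Suc_I2[rotated])
qed

text \<open>The walk goes round in one direction, chosen by the sign of \<open>s\<close>. With
  \<open>cycle_walk_offset\<close> this makes the distance the least |s| over all s congruent to y-x
  modulo \<open>n\<close>.\<close>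

lemma cycle_walk_exists:
  assumes "x < n" "y < n" "int n dvd int y - int x - s"
  shows "(x, y) \<in> cycle_edges n ^^ nat \<bar>s\<bar>"
proof (cases "s \<ge> 0")
  case True
  have "y = (x + nat s) mod n"
    using True assms(3) by (simp only: eq_mod_iff_int_dvd[OF assms(2)] int_nat_eq if_True)
  then show ?thesis using True cycle_walk_forward[OF assms(1), of "nat s"] by simp
next
  case False
  have "int n dvd - (int y - int x - s)" using assms(3) by (simp only: dvd_minus_iff)
  moreover have "- (int y - int x - s) = int x - int y - int (nat (- s))" using False by simp
  ultimately have "x = (y + nat (- s)) mod n"
    by (simp only: eq_mod_iff_int_dvd[OF assms(1)])
  then have "(y, x) \<in> cycle_edges n ^^ nat (- s)" using cycle_walk_forward[OF assms(2)] by simp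
  then show ?thesis using False cycle_walk_sym by simp
qed

lemma antipodal_iff:
  assumes "n > 0"
  shows "antipodal n a b \<longleftrightarrow> even n \<and> a < n \<and> b = (a + n div 2) mod n"
proof
  assume anti: "antipodal n a b"
  then have n: "even n" and a: "a < n" and b: "b < n"
    and dist: "graph_dist (cycle_edges n) a b = n div 2"
    by (auto simp: antipodal_def)
  \<comment> \<open>Some walk exists, so the \<open>LEAST\<close> in \<open>graph_dist\<close> is
    attained.\<close>
  have "(a, b) \<in> cycle_edges n ^^ nat \<bar>int b - int a\<bar>"
    using a b by (intro cycle_walk_exists) auto
  then have "(a, b) \<in> cycle_edges n ^^ (n div 2)"
    unfolding dist[symmetric] graph_dist_def by (rule LeastI)
  then obtain s where s: "\<bar>s\<bar> \<le> int (n div 2)" "int n dvd int b - int a - s"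
    using cycle_walk_offset by blast
  have "n div 2 \<le> nat \<bar>s\<bar>"
    unfolding dist[symmetric] graph_dist_def
    by (intro Least_le cycle_walk_exists a b s)
  \<comment> \<open>Both signs lead to the same vertex, since n/2 and -n/2 are congruent modulo
    \<open>n\<close>.\<close>
  then consider "s = int (n div 2)" | "s = - int (n div 2)" using s(1) by linarith
  then have "int n dvd int b - int a - int (n div 2)"
  proof cases
    case 1
    then show ?thesis using s(2) by simp
  next
    case 2
    have "int b - int a - int (n div 2) = (int b - int a - s) - int n"
      using n 2 by (auto elim!: evenE)
    then show ?thesis using dvd_diff[OF s(2) dvd_refl] by (simp only:)
  qed
  then show "even n \<and> a < n \<and> b = (a + n div 2) mod n"
    using n a eq_mod_iff_int_dvd[OF b] by blast
next
  assume R: "even n \<and> a < n \<and> b = (a + n div 2) mod n"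
  then have b: "b < n" using assms by simp
  have "graph_dist (cycle_edges n) a b = n div 2"
    unfolding graph_dist_def
  proof (rule Least_equality)
    show "(a, b) \<in> cycle_edges n ^^ (n div 2)" using R cycle_walk_forward by blast
  next
    fix d assume "(a, b) \<in> cycle_edges n ^^ d"
    then obtain s where s: "\<bar>s\<bar> \<le> int d" "int n dvd int b - int a - s"
      using cycle_walk_offset by blast
    have "int n dvd int b - int a - int (n div 2)"
      using R eq_mod_iff_int_dvd[OF b] by blast
    from dvd_diff[OF s(2) this] have dv: "int n dvd int (n div 2) - s" by simp
    show "n div 2 \<le> d"
    proof (rule ccontr)
      assume "\<not> n div 2 \<le> d"
      \<comment> \<open>A shorter walk would put n/2 - s, a multiple of \<open>n\<close>, strictly
        between 0 and \<open>n\<close>.\<close>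
      then have "0 < int (n div 2) - s" "int (n div 2) - s < int n"
        using s(1) by linarith+
      then show False using dv zdvd_not_zless by blast
    qed
  qed
  then show "antipodal n a b" using R b by (simp add: antipodal_def)
qed


section \<open>Excluding the other cycles\<close>

text \<open>Turns the lower bound 1 on an eigenvalue 2 sin x into an upper bound on
  \<open>n\<close>.\<close>

lemma pi_sixth_le_of_half_le_sin:
  fixes x :: real
  assumes "0 \<le> x" "x \<le> pi / 2" "1 \<le> 2 * sin x"
  shows "pi / 6 \<le> x"
proof (rule ccontr)
  assume "\<not> pi / 6 \<le> x"
  then have "sin x < sin (pi / 6)" using assms by (intro sin_monotone_2pi) auto
  then show False using assms by (simp add: sin_30)
qed

text \<open>A positive eigenvalue below 1 would have its power strictly between 0 and 1, but a
  rational power is an integer.\<close>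

lemma cycle_eigenvalue_ge_1:
  assumes "n \<ge> 3" "cycle_eigenvalue n j \<ge> 0"
    and "cycle_eigenvalue n j ^ k \<in> \<rat>" "cycle_eigenvalue n j ^ k \<noteq> 0" "k \<ge> 1"
  shows "cycle_eigenvalue n j \<ge> 1"
proof (rule ccontr)
  assume "\<not> ?thesis"
  then have "cycle_eigenvalue n j ^ k < 1"
    using assms by (simp add: power_less_one_iff)
  moreover have "cycle_eigenvalue n j ^ k \<ge> 1"
    using rational_eigenvalue_power_int[OF assms(1,3)] assms(2,4)
      Ints_nonzero_abs_ge1[of "cycle_eigenvalue n j ^ k"] by simp
  ultimately show False by simp
qed

lemma sqrt_2_irrational: "sqrt 2 \<notin> \<rat>"
proof
  have "algebraic_int (sqrt 2)" by (intro algebraic_int_sqrt int_imp_algebraic_int) simp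
  moreover assume "sqrt 2 \<in> \<rat>"
  ultimately have "sqrt 2 \<in> \<int>" by (rule rational_algebraic_int_is_int)
  then obtain i :: int where i: "sqrt 2 = of_int i" by (elim Ints_cases)
  have "1 < sqrt 2" "sqrt 2 < 2" by (simp_all add: real_less_lsqrt)
  then have "1 < i" "i < 2" by (simp_all add: i)
  then show False by linarith
qed

text \<open>Index \<open>h\<close> has eigenvalue 0, so comparison with it makes
  \<open>\<tau>\<close> theta^k itself an integer multiple of pi. Indices 0 and \<open>h - 1\<close>
  then have a rational ratio of powers, and the bound theta_(h-1) >= 1 leaves \<open>h\<close> at
  most 3.\<close>

lemma transfer_time_imp_doubly_even:
  assumes n: "n = 4 * h" "h \<ge> 1" and k: "k \<ge> 1"
    and a: "a < n" and b: "b = (a + n div 2) mod n"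
    and t: "is_transfer_time (adjacency_matrix n (cycle_edges n) ^\<^sub>m k) a b \<tau>"
  shows "n = 4 \<or> n = 8 \<and> even k"
proof -
  have n3: "n \<ge> 3" "even n" using n by auto
  have \<tau>: "\<tau> > 0" using t by (simp add: is_transfer_time_def)
  have eig_0: "cycle_eigenvalue n 0 = 2" by (simp add: cycle_eigenvalue_def)
  have eig_h: "cycle_eigenvalue n h = 0"
    using n by (simp add: cycle_eigenvalue_def)
  \<comment> \<open>The index next to the quarter turn gives the smallest nonzero absolute value of
    an eigenvalue.\<close>
  have "2 * pi * real (h - 1) / real n = pi / 2 - pi / (2 * real h)"
    using n by (simp add: of_nat_diff field_simps)
  then have eig: "cycle_eigenvalue n (h - 1) = 2 * sin (pi / (2 * real h))"
    by (simp add: cycle_eigenvalue_def sin_cos_eq)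
  have zero: "(0::real) ^ k = 0" using k by simp
  have lt: "0 < n" "h - 1 < n" "h < n" using n by auto
  obtain N0 where N0: "\<tau> * 2 ^ k = pi * of_int N0" "even N0 \<longleftrightarrow> even (0 + h)"
    using transfer_time_parity[OF n3 a b t lt(1) lt(3)] unfolding eig_0 eig_h zero diff_0_right by blast
  obtain N1 where N1: "\<tau> * cycle_eigenvalue n (h - 1) ^ k = pi * of_int N1"
    "even N1 \<longleftrightarrow> even (h - 1 + h)"
    using transfer_time_parity[OF n3 a b t lt(2) lt(3)] unfolding eig_h zero diff_0_right by blast
  \<comment> \<open>No truncation occurs because \<open>h \<ge> 1\<close>, so the index sum is
    2h-1.\<close>
  have "odd N1" using N1(2) n by auto
  then have "N1 \<noteq> 0" by auto
  have "pi * of_int N0 > 0" using \<tau> by (simp flip: N0)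
  then have "N0 \<noteq> 0" by auto
  have "pi * (of_int N0 * cycle_eigenvalue n (h - 1) ^ k) =
      (\<tau> * cycle_eigenvalue n (h - 1) ^ k) * 2 ^ k"
    by (simp only: mult.assoc[symmetric] N0(1)[symmetric]) (simp only: mult_ac)
  also have "\<dots> = pi * (of_int N1 * 2 ^ k)" by (simp only: N1(1) mult.assoc)
  finally have ratio: "cycle_eigenvalue n (h - 1) ^ k = 2 ^ k * of_int N1 / of_int N0"
    using \<open>N0 \<noteq> 0\<close> by (simp add: field_simps)
  then have rat: "cycle_eigenvalue n (h - 1) ^ k \<in> \<rat>" by simp
  have ge0: "0 \<le> pi / (2 * real h)" "pi / (2 * real h) \<le> pi / 2"
    using n by (auto simp: field_simps)
  then have "cycle_eigenvalue n (h - 1) \<ge> 0"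
    unfolding eig by (intro mult_nonneg_nonneg sin_ge_zero) (use ge0 pi_gt_zero in linarith)+
  moreover have "cycle_eigenvalue n (h - 1) ^ k \<noteq> 0"
    unfolding ratio using \<open>N0 \<noteq> 0\<close> \<open>N1 \<noteq> 0\<close> by simp
  ultimately have "cycle_eigenvalue n (h - 1) \<ge> 1"
    using cycle_eigenvalue_ge_1[OF n3(1) _ rat _ k] by blast
  then have "pi / 6 \<le> pi / (2 * real h)"
    unfolding eig using ge0 by (intro pi_sixth_le_of_half_le_sin)
  then have "h \<le> 3" using n by (simp add: field_simps)
  then consider "h = 1" | "h = 2" | "h = 3" using n by linarith
  then show ?thesis
  proof cases
    case 1
    then show ?thesis using n by simp
  next
    case 2
    have "even k"
    proof (rule ccontr)
      assume "odd k"
      then obtain q where q: "k = 2 * q + 1" by (elim oddE)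
      have "cycle_eigenvalue n (h - 1) = sqrt 2"
        unfolding eig using 2 by (simp add: sin_45)
      then have "sqrt 2 * 2 ^ q \<in> \<rat>" using rat by (simp add: q power_mult)
      then have "(sqrt 2 * 2 ^ q) / 2 ^ q \<in> \<rat>" by (intro Rats_divide) auto
      then show False using sqrt_2_irrational by simp
    qed
    then show ?thesis using 2 n by simp
  next
    \<comment> \<open>For \<open>n = 12\<close>, \<open>N0 = 2 ^ k * N1\<close> is even but has the
      parity of \<open>h = 3\<close>; the case is contradictory.\<close>
    case 3
    then have "cycle_eigenvalue n (h - 1) = 1"
      unfolding eig by (simp add: sin_30)
    then have "real_of_int N0 = of_int (2 ^ k * N1)"
      using ratio \<open>N0 \<noteq> 0\<close> by (simp add: field_simps)
    then have "N0 = 2 ^ k * N1" by linarith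
    then show ?thesis using N0(2) 3 k by simp
  qed
qed

text \<open>Here 0 is not an eigenvalue. Instead, l and n/2 - l have opposite eigenvalues and
  opposite parities: the pair 0, 2j+1 supplies the reference value 2^k, and the pair j, j+1 the
  smallest absolute value.\<close>

lemma no_transfer_time_singly_even:
  assumes n: "n = 4 * j + 2" "j \<ge> 1" and k: "k \<ge> 1"
    and a: "a < n" and b: "b = (a + n div 2) mod n"
    and t: "is_transfer_time (adjacency_matrix n (cycle_edges n) ^\<^sub>m k) a b \<tau>"
  shows False
proof -
  have n3: "n \<ge> 3" "even n" using n by auto
  have \<tau>: "\<tau> > 0" using t by (simp add: is_transfer_time_def)
  have eig_0: "cycle_eigenvalue n 0 = 2" by (simp add: cycle_eigenvalue_def)
  have "2 * pi * real (2 * j + 1) / real n = pi"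
    using n by (simp add: field_simps)
  then have eig_m: "cycle_eigenvalue n (2 * j + 1) = - 2"
    by (simp only: cycle_eigenvalue_def cos_pi)
  have "2 * pi * real j / real n = pi / 2 - pi / real n"
    using n by (simp add: field_simps)
  then have eig: "cycle_eigenvalue n j = 2 * sin (pi / real n)"
    by (simp add: cycle_eigenvalue_def sin_cos_eq)
  have "2 * pi * real (j + 1) / real n = pi / 2 + pi / real n"
    using n by (simp add: field_simps)
  then have "cycle_eigenvalue n (j + 1) = 2 * cos (pi / 2 + pi / real n)"
    by (simp only: cycle_eigenvalue_def)
  then have eig': "cycle_eigenvalue n (j + 1) = - cycle_eigenvalue n j"
    by (simp add: eig cos_add)
  have lt: "0 < n" "2 * j + 1 < n" "j < n" "j + 1 < n" using n by auto
  obtain N0 where N0: "\<tau> * (2 ^ k - (- 2) ^ k) = pi * of_int N0" "even N0 \<longleftrightarrow> even (0 + (2 * j + 1))"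
    using transfer_time_parity[OF n3 a b t lt(1,2)] unfolding eig_0 eig_m by blast
  have "odd N0" using N0(2) by simp
  then have "N0 \<noteq> 0" by auto
  \<comment> \<open>For even \<open>k\<close> the left-hand side of \<open>N0\<close>
    vanishes.\<close>
  then have "odd k" using N0(1) by auto
  obtain N1 where N1: "\<tau> * (cycle_eigenvalue n j ^ k - (- cycle_eigenvalue n j) ^ k) = pi * of_int N1"
    "even N1 \<longleftrightarrow> even (j + (j + 1))"
    using transfer_time_parity[OF n3 a b t lt(3,4)] unfolding eig' by blast
  have "odd N1" using N1(2) by simp
  then have "N1 \<noteq> 0" by auto
  have "\<tau> * (2 * 2 ^ k) = pi * of_int N0"
    using N0(1) \<open>odd k\<close> by (simp add: power_minus_odd)
  then have "pi * (of_int N0 * cycle_eigenvalue n j ^ k) = (\<tau> * (2 * cycle_eigenvalue n j ^ k)) * 2 ^ k"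
    by (metis mult.assoc mult.commute)
  also have "\<tau> * (2 * cycle_eigenvalue n j ^ k) = pi * of_int N1"
    using N1(1) \<open>odd k\<close> by (simp add: power_minus_odd)
  finally have ratio: "cycle_eigenvalue n j ^ k = 2 ^ k * of_int N1 / of_int N0"
    using \<open>N0 \<noteq> 0\<close> by (simp add: field_simps)
  then have rat: "cycle_eigenvalue n j ^ k \<in> \<rat>" by simp
  have ge0: "0 \<le> pi / real n" "pi / real n \<le> pi / 2"
    using n by (auto simp: field_simps)
  then have "cycle_eigenvalue n j \<ge> 0"
    unfolding eig by (intro mult_nonneg_nonneg sin_ge_zero) (use ge0 pi_gt_zero in linarith)+
  then have "cycle_eigenvalue n j \<ge> 1"
    using cycle_eigenvalue_ge_1[OF n3(1) _ rat _ k] ratio \<open>N0 \<noteq> 0\<close> \<open>N1 \<noteq> 0\<close> by simp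
  then have "pi / 6 \<le> pi / real n"
    unfolding eig using ge0 by (intro pi_sixth_le_of_half_le_sin)
  then have "n \<le> 6" using n by (simp add: field_simps)
  then have "n = 6" using n by linarith
  \<comment> \<open>For \<open>n = 6\<close>, \<open>N0 = 2 ^ k * N1\<close> is even, although its
    two indices have an odd sum.\<close>
  then have "cycle_eigenvalue n j = 1"
    unfolding eig by (simp add: sin_30)
  then have "real_of_int N0 = of_int (2 ^ k * N1)"
    using ratio \<open>N0 \<noteq> 0\<close> by (simp add: field_simps)
  then have "N0 = 2 ^ k * N1" by linarith
  then show False using \<open>odd N0\<close> k by simp
qed

section \<open>Minimal transfer times\<close>

text \<open>The eigenvalues are 2, 0, -2, 0. At time pi/2^k the even indices have phase -1 and the
  odd ones 1, so \<open>\<gamma>\<close> is -1. Indices 0 and 1 make 2^k times any transfer time a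
  positive multiple of pi.\<close>

lemma min_transfer_time_cycle_4:
  assumes k: "k \<ge> 1" and a: "a < 4" and b: "b = (a + 2) mod 4"
  shows "is_min_transfer_time (adjacency_matrix 4 (cycle_edges 4) ^\<^sub>m k) a b (pi / 2 ^ k)"
proof -
  have b': "b = (a + 4 div 2) mod 4" using b by simp
  have eig: "cycle_eigenvalue 4 0 = 2" "cycle_eigenvalue 4 1 = 0"
    "cycle_eigenvalue 4 2 = - 2" "cycle_eigenvalue 4 3 = 0"
  proof -
    show "cycle_eigenvalue 4 3 = 0"
      using cos_pi_half cos_add[of pi "pi / 2"] by (simp add: cycle_eigenvalue_def)
  qed (simp_all add: cycle_eigenvalue_def)
  have zero: "(0::real) ^ k = 0" using k by simp
  show ?thesis
    unfolding is_min_transfer_time_def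
  proof (intro conjI allI impI)
    have phases: "exp (- \<i> * of_real (pi / 2 ^ k * cycle_eigenvalue 4 j ^ k)) = - 1 * (-1) ^ j" if "j < 4" for j
    proof -
      from that consider "j = 0" | "j = 1" | "j = 2" | "j = 3" by linarith
      then show ?thesis
        by cases (cases "even k"; simp add: eig[unfolded One_nat_def] zero exp_minus)+
    qed
    show "is_transfer_time (adjacency_matrix 4 (cycle_edges 4) ^\<^sub>m k) a b (pi / 2 ^ k)"
      by (rule iffD2[OF transfer_time_antipodal_iff[OF _ _ a b']])
         (intro conjI exI[of _ "-1"] allI impI phases | simp)+
  next
    fix \<sigma> assume t: "is_transfer_time (adjacency_matrix 4 (cycle_edges 4) ^\<^sub>m k) a b \<sigma>"
    have \<sigma>: "\<sigma> > 0" using t by (simp add: is_transfer_time_def)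
    obtain N where "\<sigma> * (cycle_eigenvalue 4 0 ^ k - cycle_eigenvalue 4 1 ^ k) = pi * of_int N"
      using transfer_time_parity[OF _ _ a b' t, of 0 1] by auto
    then have N: "\<sigma> * 2 ^ k = pi * of_int N" by (simp only: eig zero diff_0_right)
    have "pi * of_int N > 0" using \<sigma> by (simp flip: N)
    then have "N \<ge> 1" by (simp add: zero_less_mult_iff)
    then have "pi * 1 \<le> pi * of_int N" by (intro mult_left_mono) auto
    then show "pi / 2 ^ k \<le> \<sigma>" unfolding N[symmetric] by (simp add: field_simps)
  qed
qed

text \<open>The squared eigenvalues are 4, 2, 0, 2, repeated. At time pi/2^q the odd indices have
  phase -1 and the even ones 1, so \<open>\<gamma>\<close> is 1; indices 1 and 2 give the lower
  bound.\<close>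

lemma min_transfer_time_cycle_8:
  assumes q: "q \<ge> 1" and a: "a < 8" and b: "b = (a + 4) mod 8"
  shows "is_min_transfer_time (adjacency_matrix 8 (cycle_edges 8) ^\<^sub>m (2 * q)) a b (pi / 2 ^ q)"
proof -
  have b': "b = (a + 8 div 2) mod 8" using b by simp
  have sq: "cycle_eigenvalue 8 j ^ (2 * q) = (2 + 2 * cos (pi * real j / 2)) ^ q" for j
  proof -
    have "(cycle_eigenvalue 8 j)\<^sup>2 = 2 + 2 * cos (2 * (pi * real j / 4))"
      by (simp only: cos_double_cos) (simp add: cycle_eigenvalue_def power_mult_distrib)
    then show ?thesis by (simp add: power_mult)
  qed
  have zero: "(0::real) ^ q = 0" using q by simp
  have eig: "cycle_eigenvalue 8 j ^ (2 * q) = (if even j then if 4 dvd j then 4 ^ q else 0 else 2 ^ q)" for j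
  proof (cases "even j")
    case True
    then obtain i where "j = 2 * i" by (elim evenE)
    then show ?thesis by (cases "even i") (auto simp: sq zero)
  next
    case False
    then have "odd (int j)" by simp
    then have "cos (pi * real j / 2) = 0"
      unfolding cos_zero_iff_int by (intro exI[of _ "int j"]) auto
    then show ?thesis using False by (simp add: sq)
  qed
  show ?thesis
    unfolding is_min_transfer_time_def
  proof (intro conjI allI impI)
    have phases: "exp (- \<i> * of_real (pi / 2 ^ q * cycle_eigenvalue 8 j ^ (2 * q))) = 1 * (-1) ^ j" if "j < 8" for j
    proof (cases "even j")
      case True
      have "pi / 2 ^ q * 4 ^ q = 2 ^ q * pi"
        by (simp flip: power_mult_distrib add: field_simps)
      moreover have "exp (- \<i> * of_real (2 ^ q * pi)) = 1"
      proof -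
        \<comment> \<open>Because \<open>q \<ge> 1\<close>, 2^q pi is a multiple of 2 pi.\<close>
        obtain p where "q = Suc p" using q by (cases q) auto
        then show ?thesis
          using cis_multiple_2pi[of "- (2 ^ p)"] by (simp add: cis_conv_exp mult_ac)
      qed
      ultimately show ?thesis using True by (simp add: eig del: of_real_mult of_real_divide)
    next
      case False
      then show ?thesis by (simp add: eig exp_minus)
    qed
    show "is_transfer_time (adjacency_matrix 8 (cycle_edges 8) ^\<^sub>m (2 * q)) a b (pi / 2 ^ q)"
      by (rule iffD2[OF transfer_time_antipodal_iff[OF _ _ a b']])
         (intro conjI exI[of _ 1] allI impI phases | simp)+
  next
    fix \<sigma> assume t: "is_transfer_time (adjacency_matrix 8 (cycle_edges 8) ^\<^sub>m (2 * q)) a b \<sigma>"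
    have \<sigma>: "\<sigma> > 0" using t by (simp add: is_transfer_time_def)
    obtain N where "\<sigma> * (cycle_eigenvalue 8 1 ^ (2 * q) - cycle_eigenvalue 8 2 ^ (2 * q)) = pi * of_int N"
      using transfer_time_parity[OF _ _ a b' t, of 1 2] by auto
    then have N: "\<sigma> * 2 ^ q = pi * of_int N" by (simp add: eig)
    have "pi * of_int N > 0" using \<sigma> by (simp flip: N)
    then have "N \<ge> 1" by (simp add: zero_less_mult_iff)
    then have "pi * 1 \<le> pi * of_int N" by (intro mult_left_mono) auto
    then show "pi / 2 ^ q \<le> \<sigma>" unfolding N[symmetric] by (simp add: field_simps)
  qed
qed

section \<open>Classification of the transfers and their minimum times\<close>

theorem theorem5p7:
  fixes n k a b :: nat and A :: "real mat"
  assumes "n \<ge> 3"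
    and "A = adjacency_matrix n (cycle_edges n)"
    and "k \<ge> 1"
    and "a < n" and "b < n" and "a \<noteq> b"
  shows "(PST (A ^\<^sub>m k) a b \<longleftrightarrow>
            (n = 4 \<and> antipodal n a b) \<or> (n = 8 \<and> antipodal n a b \<and> even k))
       \<and> (n = 4 \<and> antipodal n a b \<longrightarrow>
            is_min_transfer_time (A ^\<^sub>m k) a b (pi / 2 ^ k))
       \<and> (\<forall>q. n = 8 \<and> antipodal n a b \<and> k = 2 * q \<longrightarrow>
            is_min_transfer_time (A ^\<^sub>m k) a b (pi / 2 ^ q))"
proof -
  have anti: "antipodal n a b \<longleftrightarrow> even n \<and> a < n \<and> b = (a + n div 2) mod n"
    using assms(1) by (intro antipodal_iff) simp
  have min_4: "is_min_transfer_time (A ^\<^sub>m k) a b (pi / 2 ^ k)" if "n = 4" "antipodal n a b"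
    using min_transfer_time_cycle_4[OF assms(3), of a b] that anti by (simp add: assms(2))
  have min_8: "is_min_transfer_time (A ^\<^sub>m k) a b (pi / 2 ^ q)"
    if "n = 8" "antipodal n a b" "k = 2 * q" for q
    using min_transfer_time_cycle_8[of q a b] assms(3) that anti by (simp add: assms(2))
  have "(n = 4 \<and> antipodal n a b) \<or> (n = 8 \<and> antipodal n a b \<and> even k)"
    if "is_transfer_time (A ^\<^sub>m k) a b \<tau>" for \<tau>
  proof -
    have t: "is_transfer_time (adjacency_matrix n (cycle_edges n) ^\<^sub>m k) a b \<tau>"
      using that by (simp only: assms(2))
    have off: "even n" "b = (a + n div 2) mod n"
      using transfer_time_antipodal_offset[OF assms(1,4,5,6) t] by blast+
    show ?thesis
    \<comment> \<open>The split decides whether 0 is an eigenvalue of the cycle.\<close>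
    proof (cases "4 dvd n")
      case True
      then obtain h where "n = 4 * h" ..
      then have "n = 4 \<or> n = 8 \<and> even k"
        using assms(1) by (intro transfer_time_imp_doubly_even[OF _ _ assms(3,4) off(2) t]) auto
      then show ?thesis using anti off assms(4) by blast
    next
      case False
      define j where "j = n div 4"
      have "n = 4 * j + 2" using off(1) False unfolding j_def by presburger
      then show ?thesis
        using assms(1) no_transfer_time_singly_even[OF _ _ assms(3,4) off(2) t, of j] by simp
    qed
  qed
  \<comment> \<open>For the converse, a minimum transfer time is in particular a transfer
    time.\<close>
  then show ?thesis
    using min_4 min_8 unfolding PST_def is_min_transfer_time_def by (auto elim!: evenE)
qed

end
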